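(* Let $f\in\mathbb R[w_1,\dots,w_d]$ with $f\ge0$ on $\mathbb R^d$, written $f(w)=\sum_{j=1}^nc_jw^{a_{*j}}$ with $c_j\ne0$ and pairwise distinct $a_{*j}\in\mathbb N_0^d$, and let $h(w)=w^{s-1_d}$ with $s\in\mathbb R^d_{>0}$. The weight $q\in\mathbb N_0^d$ (with $q^\top1_d\ge2$) that maximizes the minimum index ratio $\mu_{(f,h)}(q)$ for $(f,h)$ is an integer multiple of $(\alpha^*_i/s_i)_{i=1}^d\in\mathbb Q^d_{\ge0}$, where $\alpha^*\in S_{d-1}$ is the optimal solution of the linear programming problem based on the multi-indexes of $f$. Moreover, the minimum index ratios satisfy $$\mu_{(f,h)}(q)\le\frac1{\lambda_{\mathrm{smplx}}},$$ and equality holds for $q_i=k\,\alpha^*_i/s_i$ $(i=1,\dots,d)$, where $k\in\mathbb N$.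
   Context: $w^a=\prod_{i=1}^dw_i^{a_i}$; $1_d$ is the all-ones vector; $a_{*j}=(a_{1j},\dots,a_{dj})^\top$; $\mathbb N_0$ is the set of non-negative integers; $S_{d-1}=\{\alpha\in\mathbb R^d:\alpha_i\ge0,\ \sum_{i=1}^d\alpha_i=1\}$. Minimum index ratio of $(f,h)$ with weight $q$: $$\mu_{(f,h)}(q)=\frac{\min_{j=1,\dots,n}q^\top a_{*j}}{q^\top s}.$$ (In the $w_i$-chart of the weighted blow-up with weight $q$, i.e. after substituting $w_i\mapsto w_i^{q_i}$ and $w_l\mapsto w_lw_i^{q_l}$ for $l\neq i$, the numerator is the exponent of $w_i$ factored out of $f$, and the denominator is one plus the exponent of $w_i$ in the transformed $h$ times the Jacobian.) Linear programming problem based on the multi-indexes of $f$: maximize $\beta$ subject to $\sum_{i=1}^d\alpha_i\frac{a_{ij}}{s_i}-\beta\ge0$ for $j=1,\dots,n$, $\sum_{i=1}^d\alpha_i=1$, $\alpha_1,\dots,\alpha_d,\beta\ge0$; $\alpha^*$ is the $\alpha$-part of the optimal solution. The simplex upper bound $\lambda_{\mathrm{smplx}}$ is defined by $\frac1{\lambda_{\mathrm{smplx}}}=\max_{\alpha\in S_{d-1}}\min_{j=1,\dots,n}\sum_{i=1}^d\alpha_i\frac{a_{ij}}{s_i}$ (the optimal value of $\beta$), with $\lambda_{\mathrm{smplx}}=\infty$ if the right-hand side is $0$.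
   Formalization: For non-integral s the claim that q is an integer multiple of a rational α*/s can fail. Proved: positive real multiple for real s; α*/s rational and m·q = k·α*/s for rational s; integer multiple for integral s; α* is some optimal solution; if α*/s is rational, some multiple of it is maximizing. *)

theory Defs
  imports "HOL-Analysis.Analysis" "HOL-Library.Extended_Real"
begin

text \<open>
  The dimension \<open>d\<close> and the number \<open>n\<close> of monomials of \<open>f\<close> are the cardinalities of the finite
  index types \<open>'d\<close> and \<open>'n\<close>; in particular \<open>n \<ge> 1\<close>, i.e. \<open>f \<noteq> 0\<close>, which the minimum over
  \<open>j = 1, ..., n\<close> presupposes. The exponents form a \<open>d \<times> n\<close> matrix \<open>a\<close> whose \<open>j\<close>-th
  column is the multi-index of the \<open>j\<close>-th monomial.
\<close>

definition monomial_nat :: "real ^ 'd::finite \<Rightarrow> nat ^ 'd \<Rightarrow> real" where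
  "monomial_nat w e = (\<Prod>i\<in>UNIV. (w $ i) ^ (e $ i))"

text \<open>Meaningful on the open positive orthant only.\<close>

definition monomial_real :: "real ^ 'd::finite \<Rightarrow> real ^ 'd \<Rightarrow> real" where
  "monomial_real w e = (\<Prod>i\<in>UNIV. (w $ i) powr (e $ i))"

definition is_weight :: "nat ^ 'd::finite \<Rightarrow> bool" where
  "is_weight q \<longleftrightarrow> (\<Sum>i\<in>UNIV. q $ i) \<ge> 2"

text \<open>The pair \<open>(f, h)\<close> enters only through the exponents \<open>a\<close> of \<open>f\<close> and \<open>s - 1\<close> of \<open>h\<close>.\<close>

definition min_index_ratio :: "nat ^ 'n::finite ^ 'd::finite \<Rightarrow> real ^ 'd \<Rightarrow> nat ^ 'd \<Rightarrow> real" where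
  "min_index_ratio a s q =
     (MIN j. \<Sum>i\<in>UNIV. real (q $ i) * real (a $ i $ j)) / (\<Sum>i\<in>UNIV. real (q $ i) * s $ i)"

definition maximizing_weight :: "nat ^ 'n::finite ^ 'd::finite \<Rightarrow> real ^ 'd \<Rightarrow> nat ^ 'd \<Rightarrow> bool" where
  "maximizing_weight a s q \<longleftrightarrow>
     is_weight q \<and> (\<forall>q'. is_weight q' \<longrightarrow> min_index_ratio a s q' \<le> min_index_ratio a s q)"

definition std_simplex :: "(real ^ 'd::finite) set" where
  "std_simplex = {\<alpha>. (\<forall>i. \<alpha> $ i \<ge> 0) \<and> (\<Sum>i\<in>UNIV. \<alpha> $ i) = 1}"

definition lp_feasible :: "nat ^ 'n::finite ^ 'd::finite \<Rightarrow> real ^ 'd \<Rightarrow> real ^ 'd \<Rightarrow> real \<Rightarrow> bool" where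
  "lp_feasible a s \<alpha> \<beta> \<longleftrightarrow>
     (\<forall>j. (\<Sum>i\<in>UNIV. \<alpha> $ i * (real (a $ i $ j) / s $ i)) - \<beta> \<ge> 0) \<and>
     (\<Sum>i\<in>UNIV. \<alpha> $ i) = 1 \<and> (\<forall>i. \<alpha> $ i \<ge> 0) \<and> \<beta> \<ge> 0"

text \<open>\<open>\<alpha>\<close> is the \<open>\<alpha>\<close>-part of an optimal solution (which need not be unique).\<close>

definition lp_optimal :: "nat ^ 'n::finite ^ 'd::finite \<Rightarrow> real ^ 'd \<Rightarrow> real ^ 'd \<Rightarrow> bool" where
  "lp_optimal a s \<alpha> \<longleftrightarrow>
     (\<exists>\<beta>. lp_feasible a s \<alpha> \<beta> \<and> (\<forall>\<alpha>' \<beta>'. lp_feasible a s \<alpha>' \<beta>' \<longrightarrow> \<beta>' \<le> \<beta>))"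

text \<open>The supremum is a maximum: a continuous function on a nonempty compact set.\<close>

definition simplex_value :: "nat ^ 'n::finite ^ 'd::finite \<Rightarrow> real ^ 'd \<Rightarrow> real" where
  "simplex_value a s =
     (SUP \<alpha>\<in>std_simplex. MIN j. \<Sum>i\<in>UNIV. \<alpha> $ i * (real (a $ i $ j) / s $ i))"

definition lambda_smplx :: "nat ^ 'n::finite ^ 'd::finite \<Rightarrow> real ^ 'd \<Rightarrow> ereal" where
  "lambda_smplx a s =
     (if simplex_value a s = 0 then \<infinity> else ereal (1 / simplex_value a s))"

end

theory Submission imports Defs begin

text \<open>
  The substitution \<open>x\<^sub>i = \<alpha>\<^sub>i / s\<^sub>i\<close> turns the linear program into maximizing
  the minimum of the \<open>a\<^sub>j \<bullet> x\<close> over the slice \<open>s \<bullet> x = 1\<close> of the nonnegative orthant.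
  The minimum index ratio is the corresponding homogeneous quotient, so its bound is immediate, and
  weights attaining the bound are exactly the integer points on the rays through optimal \<open>x\<close>.
  The only real issue is the existence of such a weight when \<open>s\<close> is irrational: by simultaneous
  Diophantine approximation of an optimal \<open>x\<close> there is an integer vector on which finitely many
  given integer linear forms have the same signs as on \<open>x\<close>. With the forms \<open>x\<^sub>i\<close> and
  \<open>(a\<^sub>j - a\<^sub>k) \<bullet> x\<close>, where \<open>a\<^sub>k\<close> attains the minimum at \<open>x\<close>, it is optimal too.
\<close>

section \<open>Simultaneous Diophantine approximation and sign patterns of integer forms\<close>

lemma Dirichlet_approx_vec:
  fixes x :: "real ^ 'd::finite"
  assumes "\<epsilon> > 0"
  obtains N :: int and p :: "real ^ 'd"
  where "N > 0" "\<And>i. p $ i \<in> \<int>" "\<And>i. \<bar>N * x $ i - p $ i\<bar> < \<epsilon>"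
proof -
  \<comment> \<open>\<open>Dirichlet_approx_simult\<close> numbers the coordinates by naturals, so
    the index type is enumerated first.\<close>
  obtain \<phi> where \<phi>: "bij_betw \<phi> {0..<CARD('d)} (UNIV :: 'd set)"
    using ex_bij_betw_nat_finite[of "UNIV :: 'd set"] by auto
  obtain M :: nat where M: "M > 0" "1 / M < \<epsilon>"
    using real_arch_inverse[of \<epsilon>] assms by (auto simp: inverse_eq_divide)
  obtain q p where q: "0 < q"
    and p: "\<And>k. k < CARD('d) \<Longrightarrow> \<bar>of_int q * x $ \<phi> k - of_int (p k)\<bar> < 1 / real M"
    using Dirichlet_approx_simult[of M "CARD('d)" "\<lambda>k. x $ \<phi> k"] M by blast
  define \<psi> where "\<psi> = inv_into {0..<CARD('d)} \<phi>"
  have \<psi>: "\<psi> i < CARD('d)" "\<phi> (\<psi> i) = i" for i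
    using bij_betw_inv_into_right[OF \<phi>] bij_betw_apply[OF bij_betw_inv_into[OF \<phi>]]
    unfolding \<psi>_def by fastforce+
  show thesis
  proof (rule that[of q "\<chi> i. of_int (p (\<psi> i))"])
    show "\<bar>q * x $ i - (\<chi> i. of_int (p (\<psi> i))) $ i\<bar> < \<epsilon>" for i
      using p[OF \<psi>(1)[of i]] M(2) \<psi>(2)[of i] by simp
  qed (use q in auto)
qed

text \<open>Take \<open>p\<close> close to \<open>N x\<close> with \<open>N \<ge> 1\<close>. If
  \<open>D \<bullet> x \<noteq> 0\<close>, the error in \<open>D \<bullet> p\<close> is below
  \<open>\<bar>D \<bullet> x\<bar>\<close>, which is at most
  \<open>N \<bar>D \<bullet> x\<bar>\<close>, so the sign survives. If
  \<open>D \<bullet> x = 0\<close>, then \<open>D \<bullet> p\<close> is an integer of absolute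
  value below 1, hence 0. This second case needs the error to be small relative to the multiple
  \<open>N x\<close>, which is what Dirichlet's theorem provides.\<close>

lemma integer_vector_same_signs:
  fixes x :: "real ^ 'd::finite" and F :: "(real ^ 'd) set"
  assumes "finite F" and int: "\<And>D i. D \<in> F \<Longrightarrow> D $ i \<in> \<int>"
  obtains p where "\<And>i. p $ i \<in> \<int>" "\<And>D. D \<in> F \<Longrightarrow> sgn (D \<bullet> p) = sgn (D \<bullet> x)"
proof -
  \<comment> \<open>The summand 1 keeps \<open>S D\<close> positive even for \<open>D = 0\<close>
    and makes the estimate below strict.\<close>
  define S where "S D = 1 + (\<Sum>i\<in>UNIV. \<bar>D $ i\<bar>)" for D :: "real ^ 'd"
  have S: "S D > 0" for D
    unfolding S_def by (smt (verit) sum_nonneg abs_ge_zero)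
  define b where "b D = (if D \<bullet> x = 0 then 1 else \<bar>D \<bullet> x\<bar>) / S D" for D
  have b: "b D > 0" for D
    using S[of D] by (auto simp: b_def)
  \<comment> \<open>The extra element 1 makes the minimum meaningful when \<open>F\<close> is
    empty.\<close>
  have "finite (insert 1 (b ` F))" using \<open>finite F\<close> by simp
  then obtain \<epsilon> where \<epsilon>: "\<epsilon> > 0" "\<And>D. D \<in> F \<Longrightarrow> \<epsilon> \<le> b D"
    using b that[of "Min (insert 1 (b ` F))"] by (auto simp: Min_le_iff)
  obtain N :: int and p :: "real ^ 'd" where N: "N > 0" and p: "\<And>i. p $ i \<in> \<int>"
    and close: "\<And>i. \<bar>N * x $ i - p $ i\<bar> < \<epsilon>"
    using Dirichlet_approx_vec[OF \<epsilon>(1)] by blast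
  have "sgn (D \<bullet> p) = sgn (D \<bullet> x)" if D: "D \<in> F" for D
  proof -
    have "\<bar>N * (D \<bullet> x) - D \<bullet> p\<bar> = \<bar>\<Sum>i\<in>UNIV. D $ i * (N * x $ i - p $ i)\<bar>"
      by (simp add: inner_vec_def sum_distrib_left right_diff_distrib sum_subtractf mult_ac)
    also have "\<dots> \<le> (\<Sum>i\<in>UNIV. \<bar>D $ i\<bar> * \<epsilon>)"
      by (rule order_trans[OF sum_abs])
        (intro sum_mono, simp add: abs_mult mult_left_mono less_imp_le[OF close])
    also have "\<dots> < \<epsilon> * S D"
      using \<epsilon>(1) by (simp add: S_def algebra_simps sum_distrib_left)
    also have "\<dots> \<le> b D * S D"
      using \<epsilon>(2)[OF D] S[of D] by simp
    also have "\<dots> = (if D \<bullet> x = 0 then 1 else \<bar>D \<bullet> x\<bar>)"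
      using S[of D] by (simp add: b_def)
    finally have bound: "\<bar>N * (D \<bullet> x) - D \<bullet> p\<bar> < (if D \<bullet> x = 0 then 1 else \<bar>D \<bullet> x\<bar>)" .
    have Np: "1 \<le> real_of_int N" using N by linarith
    consider "D \<bullet> x = 0" | "D \<bullet> x > 0" | "D \<bullet> x < 0" by linarith
    then show ?thesis
    proof cases
      case 1
      have "D \<bullet> p \<in> \<int>"
        using int[OF D] p by (auto simp: inner_vec_def intro!: Ints_sum Ints_mult)
      then show ?thesis using 1 bound Ints_nonzero_abs_less1 by force
    next
      case 2
      then have "D \<bullet> x \<le> N * (D \<bullet> x)" using Np by simp
      then have "D \<bullet> p > 0" using 2 bound by (smt (verit))
      then show ?thesis using 2 by simp
    next
      case 3
      then have "N * (D \<bullet> x) \<le> D \<bullet> x" using Np by (simp add: mult_le_cancel_right1)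
      then have "D \<bullet> p < 0" using 3 bound by (smt (verit))
      then show ?thesis using 3 by simp
    qed
  qed
  with p show thesis using that by blast
qed

lemma finite_rats_common_denominator:
  fixes x :: "'d::finite \<Rightarrow> real"
  assumes "\<And>i. x i \<in> \<rat>"
  obtains k :: nat where "k > 0" "\<And>i. k * x i \<in> \<int>"
proof -
  have "\<exists>m::nat. m > 0 \<and> m * x i \<in> \<int>" for i
  proof -
    obtain m n :: nat where n: "n \<noteq> 0" and m: "\<bar>x i\<bar> = m / n"
      using Rats_abs_nat_div_natE[OF assms[of i]] by metis
    \<comment> \<open>The fraction represents only \<open>\<bar>x i\<bar>\<close>; the sign is
      recovered because the integers are closed under negation.\<close>
    have "\<bar>n * x i\<bar> \<in> \<int>"
      using n m by (simp add: abs_mult)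
    then show ?thesis using n by (intro exI[of _ n]) (auto simp: abs_if split: if_splits)
  qed
  then obtain m :: "'d \<Rightarrow> nat" where m: "\<And>i. m i > 0" "\<And>i. m i * x i \<in> \<int>"
    by (metis of_nat_0_less_iff)
  show thesis
  proof (rule that[of "\<Prod>i\<in>UNIV. m i"])
    show "(\<Prod>i\<in>UNIV. m i) > 0" using m(1) by (simp add: prod_pos)
    fix i
    have "real (\<Prod>i\<in>UNIV. m i) * x i = real (\<Prod>i\<in>UNIV - {i}. m i) * (m i * x i)"
      by (subst prod.remove[of _ i]) auto
    also have "\<dots> \<in> \<int>" using m(2)[of i] by (intro Ints_mult[of _ "real (m i) * x i"] Ints_of_nat)
    finally show "real (\<Prod>i\<in>UNIV. m i) * x i \<in> \<int>" .
  qed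
qed

section \<open>The minimum of the column pairings\<close>

definition real_column :: "nat ^ 'n::finite ^ 'd::finite \<Rightarrow> 'n \<Rightarrow> real ^ 'd" where
  "real_column a j = (\<chi> i. real (a $ i $ j))"

text \<open>A positively homogeneous, piecewise linear function that serves two purposes: at a
  weight it is the numerator of the index ratio, and at \<open>rescale s \<alpha>\<close> it is the
  largest \<open>\<beta>\<close> satisfying the constraints indexed by \<open>j\<close>.\<close>

definition min_pairing :: "nat ^ 'n::finite ^ 'd::finite \<Rightarrow> real ^ 'd \<Rightarrow> real" where
  "min_pairing a x = (MIN j. real_column a j \<bullet> x)"

lemma min_pairing_le: "min_pairing a x \<le> real_column a j \<bullet> x"
  by (simp add: min_pairing_def)

lemma min_pairing_attained: "\<exists>j. min_pairing a x = real_column a j \<bullet> x"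
proof -
  have "min_pairing a x \<in> range (\<lambda>j. real_column a j \<bullet> x)"
    unfolding min_pairing_def by (rule Min_in) auto
  then show ?thesis by blast
qed

lemma le_min_pairing_iff: "y \<le> min_pairing a x \<longleftrightarrow> (\<forall>j. y \<le> real_column a j \<bullet> x)"
  by (simp add: min_pairing_def)

lemma min_pairing_scaleR:
  assumes "t \<ge> 0"
  shows "min_pairing a (t *\<^sub>R x) = t * min_pairing a x"
proof (rule antisym)
  show "min_pairing a (t *\<^sub>R x) \<le> t * min_pairing a x"
    using min_pairing_attained[of a x] min_pairing_le[of a "t *\<^sub>R x"] by auto
  show "t * min_pairing a x \<le> min_pairing a (t *\<^sub>R x)"
    by (simp add: le_min_pairing_iff mult_left_mono[OF min_pairing_le assms])
qed

lemma min_pairing_nonneg: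
  assumes "\<And>i. x $ i \<ge> 0"
  shows "min_pairing a x \<ge> 0"
  using assms
  by (auto simp: le_min_pairing_iff real_column_def inner_vec_def intro!: sum_nonneg)

lemma continuous_on_MIN:
  fixes g :: "'j \<Rightarrow> 'a::topological_space \<Rightarrow> 'b::linorder_topology"
  assumes "finite J" "J \<noteq> {}" "\<And>j. j \<in> J \<Longrightarrow> continuous_on S (g j)"
  shows "continuous_on S (\<lambda>x. MIN j\<in>J. g j x)"
  using assms
  by (induction rule: finite_ne_induct) (auto intro!: continuous_intros)

lemma continuous_on_min_pairing: "continuous_on S (min_pairing a)"
  unfolding min_pairing_def by (intro continuous_on_MIN continuous_intros) auto

text \<open>
  The integer vector \<open>p\<close> lies in the relative interior of the same face as the optimum \<open>x\<close>. Thus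
  \<open>x - \<delta> p\<close> is still in the cone for small \<open>\<delta> > 0\<close>, and \<open>min_pairing\<close> is linear on the
  segment, so \<open>p\<close> cannot do worse than \<open>x\<close>.
\<close>

lemma integer_optimum:
  fixes a :: "nat ^ 'n::finite ^ 'd::finite" and s x :: "real ^ 'd"
  assumes bound: "\<And>y. (\<And>i. y $ i \<ge> 0) \<Longrightarrow> min_pairing a y \<le> v * (s \<bullet> y)"
    and x: "\<And>i. x $ i \<ge> 0" "x \<noteq> 0" "min_pairing a x = v * (s \<bullet> x)"
  obtains p :: "real ^ 'd" where "\<And>i. p $ i \<in> \<int>" "\<And>i. p $ i \<ge> 0" "p \<noteq> 0"
    "min_pairing a p = v * (s \<bullet> p)"
proof -
  obtain j0 where j0: "min_pairing a x = real_column a j0 \<bullet> x"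
    using min_pairing_attained by blast
  define F where "F = range (\<lambda>i. axis i (1 :: real)) \<union> range (\<lambda>j. real_column a j - real_column a j0)"
  have F_fin: "finite F" by (simp add: F_def)
  have F_int: "D $ i \<in> \<int>" if "D \<in> F" for D i
    using that by (auto simp: F_def axis_def real_column_def)
  have F_nonneg: "D \<bullet> x \<ge> 0" if "D \<in> F" for D
    using that x(1) min_pairing_le[of a x] j0
    by (auto simp: F_def inner_axis' inner_diff_left)
  obtain p where p_int: "\<And>i. p $ i \<in> \<int>" and p_sgn: "\<And>D. D \<in> F \<Longrightarrow> sgn (D \<bullet> p) = sgn (D \<bullet> x)"
    using integer_vector_same_signs[OF F_fin F_int] by blast
  have Dp: "D \<bullet> p \<ge> 0" if "D \<in> F" for D
    using p_sgn[OF that] F_nonneg[OF that] by (metis zero_le_sgn_iff)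
  have p_nonneg: "p $ i \<ge> 0" for i
    using Dp[of "axis i 1"] by (simp add: F_def inner_axis')
  have "p \<noteq> 0"
  proof
    assume "p = 0"
    then have "x $ i = 0" for i
      using p_sgn[of "axis i 1"] by (simp add: F_def inner_axis' sgn_0_0)
    then show False using x(2) by (simp add: vec_eq_iff)
  qed
  \<comment> \<open>Forms vanishing at \<open>x\<close> also vanish at \<open>p\<close>; those
    positive at \<open>x\<close> stay positive for small \<open>\<delta>\<close> by continuity.
    Finiteness of \<open>F\<close> gives a common \<open>\<delta>\<close>.\<close>
  have "\<exists>\<delta>>0. \<forall>D\<in>F. D \<bullet> (x - \<delta> *\<^sub>R p) \<ge> 0"
  proof -
    have "\<forall>\<^sub>F \<delta> in at_right 0. D \<bullet> (x - \<delta> *\<^sub>R p) \<ge> 0" if D: "D \<in> F" for D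
    proof (cases "D \<bullet> x = 0")
      case True
      then have "D \<bullet> p = 0" using p_sgn[OF D] by (simp add: sgn_0_0)
      with True show ?thesis by (simp add: inner_diff_right)
    next
      case False
      then have "D \<bullet> x > 0" using F_nonneg[OF D] by simp
      have "((\<lambda>\<delta>. D \<bullet> (x - \<delta> *\<^sub>R p)) \<longlongrightarrow> D \<bullet> (x - 0 *\<^sub>R p)) (at_right 0)"
        by (intro tendsto_intros)
      then have "\<forall>\<^sub>F \<delta> in at_right 0. D \<bullet> (x - \<delta> *\<^sub>R p) > 0"
        using \<open>D \<bullet> x > 0\<close> by (intro order_tendstoD) auto
      then show ?thesis by eventually_elim simp
    qed
    then have "\<forall>\<^sub>F \<delta> in at_right 0. \<forall>D\<in>F. D \<bullet> (x - \<delta> *\<^sub>R p) \<ge> 0"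
      using F_fin by (intro eventually_ball_finite) auto
    then have "\<forall>\<^sub>F \<delta>::real in at_right 0. \<delta> > 0 \<and> (\<forall>D\<in>F. D \<bullet> (x - \<delta> *\<^sub>R p) \<ge> 0)"
      using eventually_at_right_less[of "0::real"] by eventually_elim simp
    then show ?thesis using eventually_happens by force
  qed
  then obtain \<delta> where \<delta>: "\<delta> > 0" "\<And>D. D \<in> F \<Longrightarrow> D \<bullet> (x - \<delta> *\<^sub>R p) \<ge> 0" by blast
  \<comment> \<open>Where the difference forms are nonnegative, column \<open>j0\<close> attains the
    minimum. This applies to \<open>x\<close>, \<open>p\<close> and \<open>x - \<delta> p\<close>
    alike and yields the linearity.\<close>
  have min_j0: "min_pairing a y = real_column a j0 \<bullet> y" if "\<And>D. D \<in> F \<Longrightarrow> D \<bullet> y \<ge> 0" for y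
  proof (rule antisym[OF min_pairing_le])
    have "(real_column a j - real_column a j0) \<bullet> y \<ge> 0" for j
      using that by (simp add: F_def)
    then show "real_column a j0 \<bullet> y \<le> min_pairing a y"
      by (simp add: le_min_pairing_iff inner_diff_left)
  qed
  have "(x - \<delta> *\<^sub>R p) $ i \<ge> 0" for i
    using \<delta>(2)[of "axis i 1"] by (simp add: F_def inner_axis')
  then have "min_pairing a (x - \<delta> *\<^sub>R p) \<le> v * (s \<bullet> (x - \<delta> *\<^sub>R p))"
    by (rule bound)
  then have "min_pairing a x - \<delta> * min_pairing a p \<le> v * (s \<bullet> x) - \<delta> * (v * (s \<bullet> p))"
    using min_j0[OF \<delta>(2)] min_j0[OF Dp] j0 by (simp add: inner_diff_right algebra_simps)
  \<comment> \<open>The terms at \<open>x\<close> cancel because \<open>x\<close> attains the bound;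
    dividing by \<open>-\<delta>\<close> reverses the inequality.\<close>
  then have "v * (s \<bullet> p) \<le> min_pairing a p"
    using x(3) \<delta>(1) by simp
  then have "min_pairing a p = v * (s \<bullet> p)"
    using bound[of p] p_nonneg by force
  with p_int p_nonneg \<open>p \<noteq> 0\<close> show thesis using that by blast
qed

section \<open>The linear program in rescaled coordinates\<close>

definition weight_vec :: "nat ^ 'd::finite \<Rightarrow> real ^ 'd" where
  "weight_vec q = (\<chi> i. real (q $ i))"

definition rescale :: "real ^ 'd::finite \<Rightarrow> real ^ 'd \<Rightarrow> real ^ 'd" where
  "rescale s \<alpha> = (\<chi> i. \<alpha> $ i / s $ i)"

lemma min_index_ratio_eq:
  "min_index_ratio a s q = min_pairing a (weight_vec q) / (s \<bullet> weight_vec q)"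
  by (simp add: min_index_ratio_def min_pairing_def real_column_def weight_vec_def
      inner_vec_def mult.commute)

lemma simplex_value_eq:
  "simplex_value a s = (SUP \<alpha>\<in>std_simplex. min_pairing a (rescale s \<alpha>))"
  by (simp add: simplex_value_def min_pairing_def real_column_def rescale_def
      inner_vec_def mult.commute)

lemma lp_feasible_iff:
  "lp_feasible a s \<alpha> \<beta> \<longleftrightarrow> \<alpha> \<in> std_simplex \<and> 0 \<le> \<beta> \<and> \<beta> \<le> min_pairing a (rescale s \<alpha>)"
  by (auto simp: lp_feasible_def le_min_pairing_iff real_column_def rescale_def std_simplex_def
      inner_vec_def mult.commute)

lemma compact_std_simplex: "compact (std_simplex :: (real ^ 'd::finite) set)"
proof -
  have "closed (std_simplex :: (real ^ 'd) set)"
    unfolding std_simplex_def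
    by (intro closed_Collect_conj closed_Collect_all closed_Collect_le closed_Collect_eq continuous_intros)
  moreover have "\<bar>\<alpha> $ i\<bar> \<le> 1" if "\<alpha> \<in> std_simplex" for \<alpha> :: "real ^ 'd" and i
    using that member_le_sum[of i UNIV "\<lambda>i. \<alpha> $ i"] by (auto simp: std_simplex_def)
  then have "bounded (std_simplex :: (real ^ 'd) set)"
    by (intro boundedI[of _ "real CARD('d)"])
      (auto intro!: order_trans[OF norm_le_l1_cart] order_trans[OF sum_bounded_above[of _ _ 1]])
  ultimately show ?thesis by (simp add: compact_eq_bounded_closed)
qed

lemma axis_in_std_simplex: "axis i 1 \<in> (std_simplex :: (real ^ 'd::finite) set)"
  by (auto simp: std_simplex_def axis_def)

lemma rescale_nonneg:
  assumes "\<And>i. s $ i > 0" "\<alpha> \<in> std_simplex"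
  shows "rescale s \<alpha> $ i \<ge> 0"
  using assms(2) less_imp_le[OF assms(1)] by (simp add: rescale_def std_simplex_def)

lemma inner_rescale:
  assumes "\<And>i. s $ i > 0" "\<alpha> \<in> std_simplex"
  shows "s \<bullet> rescale s \<alpha> = 1"
  using assms(2) less_imp_neq[OF assms(1)]
  by (simp add: rescale_def std_simplex_def inner_vec_def)

lemma rescale_nonzero:
  assumes "\<And>i. s $ i > 0" "\<alpha> \<in> std_simplex"
  shows "rescale s \<alpha> \<noteq> 0"
  using inner_rescale[OF assms] by auto

lemma simplex_value_attained:
  "\<exists>\<alpha>\<in>std_simplex. min_pairing a (rescale s \<alpha>) = simplex_value a s"
  and min_pairing_rescale_le:
  "\<alpha> \<in> std_simplex \<Longrightarrow> min_pairing a (rescale s \<alpha>) \<le> simplex_value a s"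
proof -
  have "continuous_on std_simplex (\<lambda>\<alpha>. min_pairing a (rescale s \<alpha>))"
    \<comment> \<open>As a product with the constant \<open>inverse (s $ i)\<close>, each coordinate
      is visibly continuous in \<open>\<alpha>\<close>.\<close>
    unfolding rescale_def divide_inverse
    by (intro continuous_on_compose2[OF continuous_on_min_pairing[of UNIV]] continuous_intros) auto
  then obtain \<alpha> where \<alpha>: "\<alpha> \<in> std_simplex"
    "\<And>\<alpha>'. \<alpha>' \<in> std_simplex \<Longrightarrow> min_pairing a (rescale s \<alpha>') \<le> min_pairing a (rescale s \<alpha>)"
    using continuous_attains_sup[OF compact_std_simplex, of "\<lambda>\<alpha>. min_pairing a (rescale s \<alpha>)"]
      axis_in_std_simplex by (metis empty_iff)
  then have "simplex_value a s = min_pairing a (rescale s \<alpha>)"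
    unfolding simplex_value_eq by (intro cSup_eq_maximum) auto
  with \<alpha> show "\<exists>\<alpha>\<in>std_simplex. min_pairing a (rescale s \<alpha>) = simplex_value a s"
    and "\<alpha> \<in> std_simplex \<Longrightarrow> min_pairing a (rescale s \<alpha>) \<le> simplex_value a s" for \<alpha>
    by auto
qed

lemma simplex_value_nonneg:
  assumes "\<And>i. s $ i > 0"
  shows "simplex_value a s \<ge> 0"
  using simplex_value_attained[of a s] min_pairing_nonneg rescale_nonneg[OF assms] by metis

text \<open>In \<open>ereal\<close>, \<open>1 / \<infinity> = 0\<close>, so the case of value 0 fits
  the same formula. The claims about \<open>lambda_smplx\<close> thereby become claims about real
  numbers.\<close>

lemma inverse_lambda_smplx:
  assumes "\<And>i. s $ i > 0"
  shows "1 / lambda_smplx a s = ereal (simplex_value a s)"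
  using simplex_value_nonneg[OF assms, of a] by (auto simp: lambda_smplx_def one_ereal_def)

lemma lp_optimal_iff:
  assumes "\<And>i. s $ i > 0"
  shows "lp_optimal a s \<alpha> \<longleftrightarrow>
    \<alpha> \<in> std_simplex \<and> min_pairing a (rescale s \<alpha>) = simplex_value a s" (is "?L \<longleftrightarrow> ?R")
proof
  assume ?L
  then obtain \<beta> where \<beta>: "\<alpha> \<in> std_simplex" "\<beta> \<le> min_pairing a (rescale s \<alpha>)"
    and max: "\<And>\<alpha>' \<beta>'. lp_feasible a s \<alpha>' \<beta>' \<Longrightarrow> \<beta>' \<le> \<beta>"
    by (auto simp: lp_optimal_def lp_feasible_iff)
  obtain \<alpha>' where "\<alpha>' \<in> std_simplex" "min_pairing a (rescale s \<alpha>') = simplex_value a s"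
    using simplex_value_attained by blast
  \<comment> \<open>The maximizer \<open>\<alpha>'\<close> is feasible with
    \<open>\<beta>' = simplex_value a s\<close>; the constraint \<open>\<beta>' \<ge> 0\<close>
    holds because the simplex value is nonnegative.\<close>
  then have "simplex_value a s \<le> \<beta>"
    using max[of \<alpha>' "simplex_value a s"] simplex_value_nonneg[OF assms, of a] by (simp add: lp_feasible_iff)
  then show ?R
    using \<beta> min_pairing_rescale_le[OF \<beta>(1), of a s] by force
next
  assume ?R
  then show ?L
    using simplex_value_nonneg[OF assms, of a] min_pairing_rescale_le[of _ a s]
    unfolding lp_optimal_def lp_feasible_iff by (intro exI[of _ "simplex_value a s"]) force
qed

lemma inner_pos_of_nonneg:
  fixes s y :: "real ^ 'd::finite"
  assumes "\<And>i. s $ i > 0" "\<And>i. y $ i \<ge> 0" "y \<noteq> 0"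
  shows "s \<bullet> y > 0"
proof -
  obtain i where "y $ i \<noteq> 0" using assms(3) by (auto simp: vec_eq_iff)
  then have "s $ i * y $ i > 0" using assms(1,2)[of i] by (simp add: less_le)
  then show ?thesis
    using assms(1,2) unfolding inner_vec_def
    by (auto intro!: sum_pos2[of UNIV i] mult_nonneg_nonneg simp: less_imp_le)
qed

text \<open>Radial projection of \<open>y\<close> onto the slice \<open>s \<bullet> x = 1\<close>,
  followed by the inverse of \<open>rescale s\<close>. It recovers the simplex point belonging to
  the ray through a weight.\<close>

definition normalize_vec :: "real ^ 'd::finite \<Rightarrow> real ^ 'd \<Rightarrow> real ^ 'd" where
  "normalize_vec s y = (\<chi> i. s $ i * y $ i / (s \<bullet> y))"

lemma normalize_vec:
  fixes s y :: "real ^ 'd::finite"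
  assumes "\<And>i. s $ i > 0" "\<And>i. y $ i \<ge> 0" "y \<noteq> 0"
  shows normalize_vec_in_std_simplex: "normalize_vec s y \<in> std_simplex"
    and rescale_normalize_vec: "rescale s (normalize_vec s y) = (1 / (s \<bullet> y)) *\<^sub>R y"
    and min_pairing_normalize_vec:
      "min_pairing a (rescale s (normalize_vec s y)) = min_pairing a y / (s \<bullet> y)"
proof -
  have pos: "s \<bullet> y > 0" by (rule inner_pos_of_nonneg[OF assms])
  have "(\<Sum>i\<in>UNIV. s $ i * y $ i / (s \<bullet> y)) = 1"
    using pos by (simp add: sum_divide_distrib[symmetric]) (simp add: inner_vec_def)
  then show "normalize_vec s y \<in> std_simplex"
    using pos assms(2) less_imp_le[OF assms(1)] by (simp add: normalize_vec_def std_simplex_def)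
  show eq: "rescale s (normalize_vec s y) = (1 / (s \<bullet> y)) *\<^sub>R y"
    using less_imp_neq[OF assms(1)] by (simp add: rescale_def normalize_vec_def vec_eq_iff)
  show "min_pairing a (rescale s (normalize_vec s y)) = min_pairing a y / (s \<bullet> y)"
    unfolding eq using pos by (simp add: min_pairing_scaleR)
qed

text \<open>Homogeneity extends the bound from the slice to the cone. The form without division
  covers \<open>y = 0\<close>, which matters because \<open>integer_optimum\<close> applies the
  bound at \<open>x - \<delta> p\<close>, a point that may be zero.\<close>

lemma min_pairing_le_simplex_value:
  fixes s y :: "real ^ 'd::finite"
  assumes "\<And>i. s $ i > 0" "\<And>i. y $ i \<ge> 0"
  shows "min_pairing a y \<le> simplex_value a s * (s \<bullet> y)"
proof (cases "y = 0")
  case True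
  then show ?thesis using min_pairing_scaleR[of 0 a y] by simp
next
  case False
  then show ?thesis
    using min_pairing_rescale_le[OF normalize_vec_in_std_simplex[OF assms False], of a s]
      inner_pos_of_nonneg[OF assms False]
    by (simp add: min_pairing_normalize_vec[OF assms False] divide_le_eq)
qed

section \<open>Index ratios of integer weights\<close>

lemma weight_vec_nonzero:
  assumes "is_weight q"
  shows "weight_vec q \<noteq> 0"
proof
  assume "weight_vec q = 0"
  then have "q $ i = 0" for i by (simp add: weight_vec_def vec_eq_iff)
  then show False using assms by (simp add: is_weight_def)
qed

lemma weight_vec_nonneg: "weight_vec q $ i \<ge> 0"
  by (simp add: weight_vec_def)

lemma inner_weight_vec_pos:
  assumes "\<And>i. s $ i > 0" "is_weight q"
  shows "s \<bullet> weight_vec q > 0"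
  using inner_pos_of_nonneg[OF assms(1) weight_vec_nonneg weight_vec_nonzero[OF assms(2)]] .

lemma min_index_ratio_le_simplex_value:
  assumes "\<And>i. s $ i > 0" "is_weight q"
  shows "min_index_ratio a s q \<le> simplex_value a s"
  using min_pairing_le_simplex_value[OF assms(1) weight_vec_nonneg] inner_weight_vec_pos[OF assms]
  by (simp add: min_index_ratio_eq divide_le_eq)

lemma weight_of_integer_vector:
  fixes p :: "real ^ 'd::finite"
  assumes "\<And>i. p $ i \<in> \<int>" "\<And>i. p $ i \<ge> 0" "p \<noteq> 0"
  obtains q where "is_weight q" "weight_vec q = 2 *\<^sub>R p"
proof -
  have "\<exists>m::nat. p $ i = m" for i
    using assms(1,2)[of i] by (metis Ints_cases of_int_0_le_iff of_int_of_nat_eq zero_le_imp_eq_int)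
  then obtain m :: "'d \<Rightarrow> nat" where m: "\<And>i. p $ i = m i" by metis
  obtain i where "p $ i \<noteq> 0" using assms(3) by (auto simp: vec_eq_iff)
  then have "1 \<le> m i" using m[of i] by simp
  also have "m i \<le> (\<Sum>i\<in>UNIV. m i)" by (intro member_le_sum) auto
  \<comment> \<open>A nonzero vector of naturals may have coordinate sum 1; doubling it ensures the
    required sum of at least 2.\<close>
  finally have "is_weight (\<chi> i. 2 * m i)"
    by (simp add: is_weight_def sum_distrib_left[symmetric])
  then show thesis
    by (rule that) (simp add: weight_vec_def vec_eq_iff m)
qed

text \<open>The ratio is homogeneous of degree 0, so only the ray of the weight counts. The vector
  \<open>p\<close> may be an integer optimum or the possibly non-integral
  \<open>rescale s \<alpha>\<close>.\<close>

lemma min_index_ratio_scaled: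
  assumes "\<And>i. s $ i > 0" "is_weight q"
    and "weight_vec q = t *\<^sub>R p" "t \<ge> 0" "min_pairing a p = v * (s \<bullet> p)"
  shows "min_index_ratio a s q = v"
  using inner_weight_vec_pos[OF assms(1,2)] assms(3-5)
  by (auto simp: min_index_ratio_eq min_pairing_scaleR)

text \<open>The ray through the chosen \<open>rescale s \<alpha>\<close> may contain no nonzero
  integer point. The weight is therefore built from the vector supplied by
  \<open>integer_optimum\<close>, possibly on another optimal ray.\<close>

lemma exists_weight_simplex_value:
  assumes s: "\<And>i. s $ i > 0"
  obtains q where "is_weight q" "min_index_ratio a s q = simplex_value a s"
proof -
  obtain \<alpha> where \<alpha>: "\<alpha> \<in> std_simplex" "min_pairing a (rescale s \<alpha>) = simplex_value a s"
    using simplex_value_attained by blast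
  obtain p where p: "\<And>i. p $ i \<in> \<int>" "\<And>i. p $ i \<ge> 0" "p \<noteq> 0"
    and val: "min_pairing a p = simplex_value a s * (s \<bullet> p)"
    using integer_optimum[OF min_pairing_le_simplex_value[OF s] rescale_nonneg[OF s \<alpha>(1)]
        rescale_nonzero[OF s \<alpha>(1)], of a] \<alpha>(2) inner_rescale[OF s \<alpha>(1)]
    by (metis mult.right_neutral)
  obtain q where q: "is_weight q" "weight_vec q = 2 *\<^sub>R p"
    using weight_of_integer_vector[OF p] by blast
  then show thesis
    using that min_index_ratio_scaled[OF s q _ val] by simp
qed

text \<open>The upper bound is attained by some weight, so maximizing means attaining it.\<close>

lemma maximizing_weight_iff:
  assumes s: "\<And>i. s $ i > 0"
  shows "maximizing_weight a s q \<longleftrightarrow> is_weight q \<and> min_index_ratio a s q = simplex_value a s"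
  using exists_weight_simplex_value[OF s, of a] min_index_ratio_le_simplex_value[OF s, of _ a]
  unfolding maximizing_weight_def by (metis order_antisym)

text \<open>If \<open>q\<close> equals \<open>t\<close> times the vector of the
  \<open>\<alpha> $ i / s $ i\<close>, then summing \<open>s $ i * q $ i\<close> forces
  \<open>t = s \<bullet> q\<close>. Hence the multiplier is real in general, rational for rational
  \<open>s\<close>, and an integer for integral \<open>s\<close>. Optimal points need not be unique,
  so \<open>\<alpha>\<close> is chosen for each maximizing weight. An irrational
  \<open>\<alpha> $ i / s $ i\<close> has no positive integer multiple in the integers, whence the
  rationality condition for realizing a prescribed \<open>\<alpha>\<close>.\<close>

theorem proposition4p16:
  fixes f h :: "real ^ 'd::finite \<Rightarrow> real"
    and c :: "real ^ 'n::finite"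
    and a :: "nat ^ 'n ^ 'd"
    and s :: "real ^ 'd"
  assumes f_eq: "\<And>w. f w = (\<Sum>j\<in>UNIV. c $ j * monomial_nat w (column j a))"
    and f_nonneg: "\<And>w. f w \<ge> 0"
    and c_nonzero: "\<And>j. c $ j \<noteq> 0"
    and a_distinct: "inj (\<lambda>j. column j a)"
    and s_pos: "\<And>i. s $ i > 0"
    and h_eq: "\<And>w. (\<forall>i. w $ i > 0) \<Longrightarrow> h w = monomial_real w (s - 1)"
  shows
    "(\<exists>q. maximizing_weight a s q \<and> ereal (min_index_ratio a s q) = 1 / lambda_smplx a s) \<and>
     (\<forall>q. maximizing_weight a s q \<longrightarrow>
        (\<exists>\<alpha>. \<alpha> \<in> std_simplex \<and> lp_optimal a s \<alpha> \<and>
           (\<exists>t::real. t > 0 \<and> (\<forall>i. real (q $ i) = t * (\<alpha> $ i / s $ i))) \<and>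
           ((\<forall>i. s $ i \<in> \<rat>) \<longrightarrow>
              (\<forall>i. \<alpha> $ i / s $ i \<in> \<rat>) \<and>
              (\<exists>m k :: nat. m > 0 \<and> k > 0 \<and>
                 (\<forall>i. real (m * q $ i) = real k * (\<alpha> $ i / s $ i)))) \<and>
           ((\<forall>i. s $ i \<in> \<int>) \<longrightarrow>
              (\<exists>k::nat. k > 0 \<and> (\<forall>i. real (q $ i) = real k * (\<alpha> $ i / s $ i)))))) \<and>
     (\<forall>\<alpha>. lp_optimal a s \<alpha> \<and> (\<forall>i. \<alpha> $ i / s $ i \<in> \<rat>) \<longrightarrow>
        (\<exists>(k::nat) q. k > 0 \<and> maximizing_weight a s q \<and>
           (\<forall>i. real (q $ i) = real k * (\<alpha> $ i / s $ i)))) \<and>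
     (\<forall>q. is_weight q \<longrightarrow> ereal (min_index_ratio a s q) \<le> 1 / lambda_smplx a s) \<and>
     (\<forall>\<alpha> (k::nat) q. lp_optimal a s \<alpha> \<and> is_weight q \<and>
        (\<forall>i. real (q $ i) = real k * (\<alpha> $ i / s $ i)) \<longrightarrow>
        ereal (min_index_ratio a s q) = 1 / lambda_smplx a s)"
proof -
  note s = s_pos
  let ?v = "simplex_value a s"
  have ratio_of_optimal: "min_index_ratio a s q = ?v"
    if opt: "lp_optimal a s \<alpha>" and q: "is_weight q" "\<forall>i. real (q $ i) = real k * (\<alpha> $ i / s $ i)"
    for \<alpha> and k :: nat and q
  proof -
    have "\<alpha> \<in> std_simplex" "min_pairing a (rescale s \<alpha>) = ?v"
      using opt lp_optimal_iff[OF s] by auto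
    moreover have "weight_vec q = real k *\<^sub>R rescale s \<alpha>"
      using q(2) by (simp add: weight_vec_def rescale_def vec_eq_iff)
    ultimately show ?thesis
      using min_index_ratio_scaled[OF s q(1), of "real k" "rescale s \<alpha>" a ?v]
        inner_rescale[OF s, of \<alpha>] by simp
  qed
  have exist: "\<exists>q. maximizing_weight a s q \<and> min_index_ratio a s q = ?v"
    using exists_weight_simplex_value[OF s] maximizing_weight_iff[OF s] by metis
  have maximizers: "\<exists>\<alpha>. \<alpha> \<in> std_simplex \<and> lp_optimal a s \<alpha> \<and>
      (\<exists>t::real. t > 0 \<and> (\<forall>i. real (q $ i) = t * (\<alpha> $ i / s $ i))) \<and>
      ((\<forall>i. s $ i \<in> \<rat>) \<longrightarrow>
         (\<forall>i. \<alpha> $ i / s $ i \<in> \<rat>) \<and>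
         (\<exists>m k :: nat. m > 0 \<and> k > 0 \<and>
            (\<forall>i. real (m * q $ i) = real k * (\<alpha> $ i / s $ i)))) \<and>
      ((\<forall>i. s $ i \<in> \<int>) \<longrightarrow>
         (\<exists>k::nat. k > 0 \<and> (\<forall>i. real (q $ i) = real k * (\<alpha> $ i / s $ i))))"
    if max: "maximizing_weight a s q" for q
  proof -
    let ?y = "weight_vec q"
    \<comment> \<open>The weight itself determines its optimal point by normalization, and
      \<open>t\<close> is the factor removed.\<close>
    define \<alpha> where "\<alpha> = normalize_vec s ?y"
    define t where "t = s \<bullet> ?y"
    have q: "is_weight q" "min_index_ratio a s q = ?v"
      using max maximizing_weight_iff[OF s] by auto
    have t: "t > 0" using inner_weight_vec_pos[OF s q(1)] by (simp add: t_def)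
    note y = weight_vec_nonneg[of q] weight_vec_nonzero[OF q(1)]
    have \<alpha>: "\<alpha> \<in> std_simplex" "lp_optimal a s \<alpha>"
      using normalize_vec_in_std_simplex[OF s y] min_pairing_normalize_vec[OF s y, of a] q(2)
      by (auto simp: lp_optimal_iff[OF s] \<alpha>_def min_index_ratio_eq)
    have ratio: "\<alpha> $ i / s $ i = real (q $ i) / t" for i
      using less_imp_neq[OF s[of i]] by (simp add: \<alpha>_def normalize_vec_def weight_vec_def t_def)
    have t_sum: "t = (\<Sum>i\<in>UNIV. s $ i * real (q $ i))"
      by (simp add: t_def inner_vec_def weight_vec_def)
    show ?thesis
    proof (intro exI[of _ \<alpha>] conjI impI \<alpha>)
      show "\<exists>t::real. t > 0 \<and> (\<forall>i. real (q $ i) = t * (\<alpha> $ i / s $ i))"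
        using t by (intro exI[of _ t]) (simp add: ratio)
    next
      assume "\<forall>i. s $ i \<in> \<rat>"
      then have t_rat: "t \<in> \<rat>"
        unfolding t_sum by (intro Rats_sum Rats_mult) auto
      then show "\<forall>i. \<alpha> $ i / s $ i \<in> \<rat>"
        by (simp add: ratio)
      \<comment> \<open>Clearing the denominator of \<open>t = k / m\<close> turns
        \<open>q = t * (\<alpha> / s)\<close>, read coordinatewise, into the integer
        relation.\<close>
      obtain k m :: nat where "m \<noteq> 0" "t = k / m"
        using Rats_abs_nat_div_natE[OF t_rat] t by (metis abs_of_pos)
      then have km: "real k = real m * t" "m > 0" by simp_all
      with t have "k > 0" by (metis mult_pos_pos of_nat_0_less_iff)
      with km t show "\<exists>m k :: nat. m > 0 \<and> k > 0 \<and>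
            (\<forall>i. real (m * q $ i) = real k * (\<alpha> $ i / s $ i))"
        by (intro exI[of _ m] exI[of _ k]) (simp add: ratio)
    next
      assume "\<forall>i. s $ i \<in> \<int>"
      then have "t \<in> \<int>"
        unfolding t_sum by (intro Ints_sum Ints_mult) auto
      then obtain k :: nat where "t = k"
        using t by (metis Ints_cases of_int_0_less_iff of_int_of_nat_eq pos_int_cases)
      with t show "\<exists>k::nat. k > 0 \<and> (\<forall>i. real (q $ i) = real k * (\<alpha> $ i / s $ i))"
        by (intro exI[of _ k]) (simp add: ratio)
    qed
  qed
  have rational_optimum: "\<exists>(k::nat) q. k > 0 \<and> maximizing_weight a s q \<and>
      (\<forall>i. real (q $ i) = real k * (\<alpha> $ i / s $ i))"
    if opt: "lp_optimal a s \<alpha>" and rat: "\<forall>i. \<alpha> $ i / s $ i \<in> \<rat>" for \<alpha>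
  proof -
    have \<alpha>: "\<alpha> \<in> std_simplex" using opt lp_optimal_iff[OF s] by auto
    obtain k :: nat where k: "k > 0" "\<And>i. k * (\<alpha> $ i / s $ i) \<in> \<int>"
      using finite_rats_common_denominator[of "\<lambda>i. \<alpha> $ i / s $ i"] rat by blast
    \<comment> \<open>The factor \<open>k\<close> clears denominators and the 2 guarantees a weight,
      so the final multiplier is \<open>2 * k\<close>.\<close>
    obtain q where q: "is_weight q" "weight_vec q = 2 *\<^sub>R (real k *\<^sub>R rescale s \<alpha>)"
    proof (rule weight_of_integer_vector)
      show "(real k *\<^sub>R rescale s \<alpha>) $ i \<in> \<int>" for i
        using k(2)[of i] by (simp add: rescale_def)
      show "(real k *\<^sub>R rescale s \<alpha>) $ i \<ge> 0" for i
        using rescale_nonneg[OF s \<alpha>] by simp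
      show "real k *\<^sub>R rescale s \<alpha> \<noteq> 0"
        using rescale_nonzero[OF s \<alpha>] k(1) by simp
    qed blast
    then have eq: "\<forall>i. real (q $ i) = real (2 * k) * (\<alpha> $ i / s $ i)"
      by (simp add: weight_vec_def rescale_def vec_eq_iff)
    then have "maximizing_weight a s q"
      using ratio_of_optimal[OF opt q(1)] q(1) maximizing_weight_iff[OF s] by blast
    with eq k(1) show ?thesis by (intro exI[of _ "2 * k"] exI[of _ q]) simp
  qed
  show ?thesis
    unfolding inverse_lambda_smplx[OF s] ereal_less_eq(3) ereal.inject
    by (intro conjI[OF exist] conjI allI impI; (elim conjE)?;
        intro maximizers rational_optimum min_index_ratio_le_simplex_value[OF s] ratio_of_optimal;
        assumption)
qed

end
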